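(* Let $R$ be a commutative ring and let $(M_i,\lambda_i,\partial_i)$, $i=1,2$, be formed spaces with boundary over $R$ with $\partial_i$ surjective for $i=1,2$ and such that $$(M_1,\lambda_1,\partial_1)\#X\cong(M_2,\lambda_2,\partial_2)\#X .$$ If $g_X(M_1,\lambda_1,\partial_1)\ge2\,\mathrm{usr}(R)+5$, then $(M_1,\lambda_1,\partial_1)\cong(M_2,\lambda_2,\partial_2)$.
   Context: Formed spaces with boundary. A formed space with boundary over $R$ is a triple $(M,\lambda,\partial)$ with $M$ a finitely generated free $R$-module, $\lambda:M\otimes M\to R$ an alternating bilinear form, and $\partial:M\to R$ linear. Morphisms are linear maps preserving $\lambda$ and $\partial$; the category is denoted $\mathcal{F}_\partial$, and $\cong$ is isomorphism in it. Its monoidal structure is $$(M_1,\lambda_1,\partial_1)\#(M_2,\lambda_2,\partial_2)=(M_1\oplus M_2,\lambda_1\#\lambda_2,\partial_1+\partial_2),$$ $$(\lambda_1\#\lambda_2)((x_1,x_2),(y_1,y_2))=\lambda_1(x_1,y_1)+\lambda_2(x_2,y_2)+\partial_1(x_1)\partial_2(y_2)-\partial_2(x_2)\partial_1(y_1).$$ Let $X=(R,0,\mathrm{id})$. The arc genus is $g_X(M,\lambda,\partial)=\max\{g\in\mathbb{N}: (M,\lambda,\partial)\cong M'\#X^{\# g}\text{ in }\mathcal{F}_\partial\text{ for some }M'\}$. Stable ranks. A vector (or finite sequence of vectors) in an $R$-module is unimodular if the canonical map from $R$ (resp. $R^k$) to the module is a split injection. $R$ satisfies $(S_n)$ if for every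 unimodular vector $(r_0,\dots,r_n)\in R^{n+1}$ there are $t_0,\dots,t_{n-1}\in R$ with $(r_0+t_0r_n,\dots,r_{n-1}+t_{n-1}r_n)\in R^n$ unimodular; $\mathrm{sr}(R)$ is the smallest such $n$ ($\infty$ if none). $\mathrm{usr}(R)$ is the smallest $n\ge \mathrm{sr}(R)$ such that the elementary symplectic group $\mathrm{ESp}_{2n+2}(R)$ acts transitively on the set of unimodular vectors of $R^{2n+2}$ ($\infty$ if none). Here, for the hyperbolic basis $e_1,f_1,\dots,e_m,f_m$ of $R^{2m}$ with $\lambda(e_i,f_i)=1$ and other pairings zero, $\mathrm{ESp}_{2m}(R)\le\mathrm{Sp}_{2m}(R)$ is generated by the transformations (identity on the basis vectors not mentioned), for $r\in R$ and $i\ne j$: $f_i\mapsto f_i+re_i$; $e_i\mapsto e_i+rf_i$; ($f_i\mapsto f_i+re_j$, $f_j\mapsto f_j+re_i$); ($e_i\mapsto e_i+rf_j$, $e_j\mapsto e_j+rf_i$); ($e_i\mapsto e_i+re_j$, $f_j\mapsto f_j-rf_i$). *)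

theory Defs
  imports
    Main
    "HOL-Library.Extended_Nat"
    "HOL-Library.Product_Plus"
    "HOL-Library.Function_Algebras"
begin

section \<open>Linear maps and free modules on submodules of an ambient module\<close>

definition linear_on ::
    "'m set \<Rightarrow> ('r \<Rightarrow> 'm \<Rightarrow> 'm) \<Rightarrow> ('r \<Rightarrow> 'n \<Rightarrow> 'n) \<Rightarrow> ('m::plus \<Rightarrow> 'n::plus) \<Rightarrow> bool" where
  "linear_on S s t f \<longleftrightarrow>
     (\<forall>x\<in>S. \<forall>y\<in>S. f (x + y) = f x + f y) \<and> (\<forall>r. \<forall>x\<in>S. f (s r x) = t r (f x))"

text \<open>The submodule \<open>S\<close> of the module with scalar multiplication \<open>s\<close> is finitely generated
  and free.\<close>
definition fg_free :: "('r::comm_ring_1 \<Rightarrow> 'm::ab_group_add \<Rightarrow> 'm) \<Rightarrow> 'm set \<Rightarrow> bool" where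
  "fg_free s S \<longleftrightarrow> module s \<and>
     (\<exists>B. finite B \<and> \<not> module.dependent s B \<and> module.span s B = S)"

text \<open>\<open>R\<^sup>n\<close>: sequences that vanish from index \<open>n\<close> on, so that all the \<open>R\<^sup>n\<close> live in one type.\<close>
definition coord_space :: "nat \<Rightarrow> (nat \<Rightarrow> 'r::zero) set" where
  "coord_space n = {x. \<forall>i\<ge>n. x i = 0}"

definition coord_scale :: "'r::times \<Rightarrow> (nat \<Rightarrow> 'r) \<Rightarrow> nat \<Rightarrow> 'r" where
  "coord_scale r x = (\<lambda>i. r * x i)"

definition unit_vec :: "nat \<Rightarrow> nat \<Rightarrow> 'r::zero_neq_one" where
  "unit_vec k = (\<lambda>i. if i = k then 1 else 0)"


section \<open>Formed spaces with boundary\<close>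

text \<open>The module is the submodule \<open>car M\<close> of the module structure \<open>smul M\<close> on the type \<open>'m\<close>; the
  values of \<open>form M\<close> and \<open>bd M\<close> outside \<open>car M\<close> are irrelevant.\<close>
record ('r, 'm) fspace =
  car :: "'m set"
  smul :: "'r \<Rightarrow> 'm \<Rightarrow> 'm"
  form :: "'m \<Rightarrow> 'm \<Rightarrow> 'r"
  bd :: "'m \<Rightarrow> 'r"

definition formed_space :: "('r::comm_ring_1, 'm::ab_group_add) fspace \<Rightarrow> bool" where
  "formed_space M \<longleftrightarrow>
     fg_free (smul M) (car M) \<and>
     (\<forall>x\<in>car M. linear_on (car M) (smul M) (*) (\<lambda>y. form M x y)) \<and>
     (\<forall>y\<in>car M. linear_on (car M) (smul M) (*) (\<lambda>x. form M x y)) \<and>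
     (\<forall>x\<in>car M. form M x x = 0) \<and>
     linear_on (car M) (smul M) (*) (bd M)"

definition fs_morphism ::
    "('r::comm_ring_1, 'm::ab_group_add) fspace \<Rightarrow> ('r, 'n::ab_group_add) fspace \<Rightarrow> ('m \<Rightarrow> 'n) \<Rightarrow> bool"
  where
  "fs_morphism M N f \<longleftrightarrow>
     f ` car M \<subseteq> car N \<and>
     linear_on (car M) (smul M) (smul N) f \<and>
     (\<forall>x\<in>car M. \<forall>y\<in>car M. form N (f x) (f y) = form M x y) \<and>
     (\<forall>x\<in>car M. bd N (f x) = bd M x)"

definition fs_iso ::
    "('r::comm_ring_1, 'm::ab_group_add) fspace \<Rightarrow> ('r, 'n::ab_group_add) fspace \<Rightarrow> bool"
    (infix "\<cong>\<^sub>F" 50) where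
  "M \<cong>\<^sub>F N \<longleftrightarrow> (\<exists>f g. fs_morphism M N f \<and> fs_morphism N M g \<and>
     (\<forall>x\<in>car M. g (f x) = x) \<and> (\<forall>y\<in>car N. f (g y) = y))"

definition fs_sum ::
    "('r::comm_ring_1, 'm::ab_group_add) fspace \<Rightarrow> ('r, 'n::ab_group_add) fspace
      \<Rightarrow> ('r, 'm \<times> 'n) fspace" (infixl "\<sharp>" 65) where
  "M \<sharp> N = \<lparr>
     car = car M \<times> car N,
     smul = (\<lambda>r (x, y). (smul M r x, smul N r y)),
     form = (\<lambda>(x1, x2) (y1, y2).
       form M x1 y1 + form N x2 y2 + bd M x1 * bd N y2 - bd N x2 * bd M y1),
     bd = (\<lambda>(x1, x2). bd M x1 + bd N x2)\<rparr>"

text \<open>The space \<open>X = (R, 0, id)\<close>.\<close>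
definition arc_space :: "('r::comm_ring_1, 'r) fspace" where
  "arc_space = \<lparr>car = UNIV, smul = (*), form = (\<lambda>_ _. 0), bd = (\<lambda>x. x)\<rparr>"

text \<open>\<open>X\<^bsup>\<sharp>g\<^esup>\<close> on the module \<open>R\<^sup>g\<close>. The recursion equations unfold \<open>X\<^bsup>\<sharp>g+1\<^esup> = X\<^bsup>\<sharp>g\<^esup> \<sharp> X\<close>, where
  \<open>(x, a) \<in> R\<^sup>g \<times> R\<close> is identified with \<open>x(g := a)\<close>; see \<open>arc_power_Suc\<close> below.\<close>
primrec arc_power_bd :: "nat \<Rightarrow> (nat \<Rightarrow> 'r::comm_ring_1) \<Rightarrow> 'r" where
  "arc_power_bd 0 x = 0"
| "arc_power_bd (Suc g) x = arc_power_bd g x + x g"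

primrec arc_power_form :: "nat \<Rightarrow> (nat \<Rightarrow> 'r::comm_ring_1) \<Rightarrow> (nat \<Rightarrow> 'r) \<Rightarrow> 'r" where
  "arc_power_form 0 x y = 0"
| "arc_power_form (Suc g) x y =
     arc_power_form g x y + arc_power_bd g x * y g - x g * arc_power_bd g y"

definition arc_power :: "nat \<Rightarrow> ('r::comm_ring_1, nat \<Rightarrow> 'r) fspace" where
  "arc_power g = \<lparr>car = coord_space g, smul = coord_scale,
     form = arc_power_form g, bd = arc_power_bd g\<rparr>"

text \<open>The arc genus. Letting the complement \<open>M'\<close> range over formed spaces on \<open>nat \<Rightarrow> 'r\<close> loses no
  generality by \<open>formed_space_coord_model\<close> below. The maximum is taken as a supremum in \<open>enat\<close>.\<close>
definition arc_genus :: "('r::comm_ring_1, 'm::ab_group_add) fspace \<Rightarrow> enat" where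
  "arc_genus M = Sup {enat g | g. \<exists>M' :: ('r, nat \<Rightarrow> 'r) fspace.
     formed_space M' \<and> M \<cong>\<^sub>F M' \<sharp> arc_power g}"


section \<open>Stable ranks\<close>

text \<open>The map \<open>R \<rightarrow> R\<^sup>n\<close>, \<open>r \<mapsto> r v\<close> is a split injection, i.e. has a linear left inverse.\<close>
definition unimodular :: "nat \<Rightarrow> (nat \<Rightarrow> 'r::comm_ring_1) \<Rightarrow> bool" where
  "unimodular n v \<longleftrightarrow> v \<in> coord_space n \<and>
     (\<exists>\<phi>. linear_on (coord_space n) coord_scale (*) \<phi> \<and> (\<forall>r. \<phi> (coord_scale r v) = r))"

definition stable_range :: "'r::comm_ring_1 itself \<Rightarrow> nat \<Rightarrow> bool" where
  "stable_range _ n \<longleftrightarrow> (\<forall>r :: nat \<Rightarrow> 'r. unimodular (Suc n) r \<longrightarrow>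
     (\<exists>t :: nat \<Rightarrow> 'r. unimodular n (\<lambda>i. if i < n then r i + t i * r n else 0)))"

definition sr :: "'r::comm_ring_1 itself \<Rightarrow> enat" where
  "sr R = Inf {enat n | n. stable_range R n}"

text \<open>The hyperbolic basis of \<open>R\<^bsup>2m\<^esup>\<close> is ordered as \<open>e\<^sub>0, f\<^sub>0, e\<^sub>1, f\<^sub>1, \<dots>\<close>.\<close>
abbreviation e_idx :: "nat \<Rightarrow> nat" where "e_idx i \<equiv> 2 * i"
abbreviation f_idx :: "nat \<Rightarrow> nat" where "f_idx i \<equiv> 2 * i + 1"

abbreviation e_vec :: "nat \<Rightarrow> nat \<Rightarrow> 'r::comm_ring_1" where "e_vec i \<equiv> unit_vec (e_idx i)"
abbreviation f_vec :: "nat \<Rightarrow> nat \<Rightarrow> 'r::comm_ring_1" where "f_vec i \<equiv> unit_vec (f_idx i)"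

text \<open>The linear map on \<open>R\<^sup>n\<close> sending the \<open>k\<close>-th standard basis vector to \<open>b k\<close>.\<close>
definition basis_map ::
    "nat \<Rightarrow> (nat \<Rightarrow> nat \<Rightarrow> 'r::comm_ring_1) \<Rightarrow> (nat \<Rightarrow> 'r) \<Rightarrow> nat \<Rightarrow> 'r" where
  "basis_map n b x = (\<Sum>k<n. coord_scale (x k) (b k))"

text \<open>The subgroup generated by the elementary transformations. Its elements are regarded as maps on
  \<open>R\<^bsup>2m\<^esup> = coord_space (2 * m)\<close> only.\<close>
inductive_set ESp :: "nat \<Rightarrow> ((nat \<Rightarrow> 'r::comm_ring_1) \<Rightarrow> nat \<Rightarrow> 'r) set" for m :: nat where
  gen_fe: "i < m \<Longrightarrow>
    basis_map (2 * m) (unit_vec(f_idx i := f_vec i + coord_scale r (e_vec i))) \<in> ESp m"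
| gen_ef: "i < m \<Longrightarrow>
    basis_map (2 * m) (unit_vec(e_idx i := e_vec i + coord_scale r (f_vec i))) \<in> ESp m"
| gen_ffee: "i < m \<Longrightarrow> j < m \<Longrightarrow> i \<noteq> j \<Longrightarrow>
    basis_map (2 * m) (unit_vec(f_idx i := f_vec i + coord_scale r (e_vec j),
                                f_idx j := f_vec j + coord_scale r (e_vec i))) \<in> ESp m"
| gen_eeff: "i < m \<Longrightarrow> j < m \<Longrightarrow> i \<noteq> j \<Longrightarrow>
    basis_map (2 * m) (unit_vec(e_idx i := e_vec i + coord_scale r (f_vec j),
                                e_idx j := e_vec j + coord_scale r (f_vec i))) \<in> ESp m"
| gen_eeff_mixed: "i < m \<Longrightarrow> j < m \<Longrightarrow> i \<noteq> j \<Longrightarrow>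
    basis_map (2 * m) (unit_vec(e_idx i := e_vec i + coord_scale r (e_vec j),
                                f_idx j := f_vec j - coord_scale r (f_vec i))) \<in> ESp m"
| one: "id \<in> ESp m"
| mult: "S \<in> ESp m \<Longrightarrow> T \<in> ESp m \<Longrightarrow> S \<circ> T \<in> ESp m"
| inverse: "T \<in> ESp m \<Longrightarrow> inv_into (coord_space (2 * m)) T \<in> ESp m"

definition ESp_transitive :: "'r::comm_ring_1 itself \<Rightarrow> nat \<Rightarrow> bool" where
  "ESp_transitive _ m \<longleftrightarrow> (\<forall>(v :: nat \<Rightarrow> 'r) w. unimodular (2 * m) v \<longrightarrow> unimodular (2 * m) w \<longrightarrow>
     (\<exists>T\<in>ESp m. T v = w))"

definition usr :: "'r::comm_ring_1 itself \<Rightarrow> enat" where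
  "usr R = Inf {enat n | n. sr R \<le> enat n \<and> ESp_transitive R (n + 1)}"


section \<open>Adequacy of the encodings\<close>

lemma linear_onD:
  assumes "linear_on S s t f"
  shows "x \<in> S \<Longrightarrow> y \<in> S \<Longrightarrow> f (x + y) = f x + f y"
    and "x \<in> S \<Longrightarrow> f (s r x) = t r (f x)"
  using assms by (auto simp: linear_on_def)

lemma arc_power_bd_cong: "(\<And>i. i < g \<Longrightarrow> x i = y i) \<Longrightarrow> arc_power_bd g x = arc_power_bd g y"
  by (induction g) auto

lemma arc_power_form_cong:
  "(\<And>i. i < g \<Longrightarrow> x i = x' i) \<Longrightarrow> (\<And>i. i < g \<Longrightarrow> y i = y' i) \<Longrightarrow>
    arc_power_form g x y = arc_power_form g x' y'"
proof (induction g)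
  case (Suc g)
  have "arc_power_bd g x = arc_power_bd g x'" "arc_power_bd g y = arc_power_bd g y'"
    using Suc.prems by (auto intro!: arc_power_bd_cong)
  then show ?case using Suc by simp
qed simp

lemma arc_power_0: "car (arc_power 0 :: ('r::comm_ring_1, nat \<Rightarrow> 'r) fspace) = {0}"
  by (auto simp: arc_power_def coord_space_def zero_fun_def)

lemma arc_power_Suc:
  "(arc_power (Suc g) :: ('r::comm_ring_1, nat \<Rightarrow> 'r) fspace) \<cong>\<^sub>F arc_power g \<sharp> arc_space"
proof -
  let ?P = "arc_power (Suc g) :: ('r, nat \<Rightarrow> 'r) fspace"
  let ?Q = "arc_power g \<sharp> arc_space :: ('r, (nat \<Rightarrow> 'r) \<times> 'r) fspace"
  let ?f = "\<lambda>x :: nat \<Rightarrow> 'r. (x(g := 0), x g)"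
  let ?g = "\<lambda>(x :: nat \<Rightarrow> 'r, a). x(g := a)"
  have bd [simp]: "arc_power_bd g (x(g := a)) = arc_power_bd g x" for x :: "nat \<Rightarrow> 'r" and a
    by (rule arc_power_bd_cong) simp
  have form [simp]: "arc_power_form g (x(g := a)) (y(g := b)) = arc_power_form g x y"
    for x y :: "nat \<Rightarrow> 'r" and a b
    by (rule arc_power_form_cong) simp_all
  have "fs_morphism ?P ?Q ?f"
    by (auto simp: fs_morphism_def linear_on_def fs_sum_def arc_power_def arc_space_def
        coord_space_def coord_scale_def fun_eq_iff)
  moreover have "fs_morphism ?Q ?P ?g"
    by (auto simp: fs_morphism_def linear_on_def fs_sum_def arc_power_def arc_space_def
        coord_space_def coord_scale_def fun_eq_iff)
  moreover have "\<forall>x\<in>car ?P. ?g (?f x) = x" "\<forall>y\<in>car ?Q. ?f (?g y) = y"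
    by (auto simp: fs_sum_def arc_power_def arc_space_def coord_space_def fun_eq_iff)
  ultimately show ?thesis unfolding fs_iso_def by blast
qed

lemma module_coord: "module (coord_scale :: 'r::comm_ring_1 \<Rightarrow> _)"
  by unfold_locales (auto simp: coord_scale_def fun_eq_iff algebra_simps)

lemma sum_fun_apply: "(\<Sum>i\<in>A. f i) k = (\<Sum>i\<in>A. f i k)"
  for f :: "'i \<Rightarrow> 'a \<Rightarrow> 'b::comm_monoid_add"
  by (induction A rule: infinite_finite_induct) auto

lemma fg_free_coord: "fg_free (coord_scale :: 'r::comm_ring_1 \<Rightarrow> _) (coord_space n)"
proof -
  interpret module "coord_scale :: 'r \<Rightarrow> (nat \<Rightarrow> 'r) \<Rightarrow> nat \<Rightarrow> 'r" by (rule module_coord)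
  let ?u = "unit_vec :: nat \<Rightarrow> nat \<Rightarrow> 'r"
  have inj: "inj ?u" by (auto simp: inj_def unit_vec_def fun_eq_iff split: if_splits)
  have comb: "(\<Sum>k<n. coord_scale (c k) (?u k)) i = (if i < n then c i else 0)" for c i
  proof -
    have "(\<Sum>k<n. coord_scale (c k) (?u k)) i = (\<Sum>k<n. if i = k then c k else 0)"
      by (simp add: sum_fun_apply coord_scale_def unit_vec_def if_distrib cong: if_cong)
    then show ?thesis by simp
  qed
  have "independent (?u ` {..<n})"
  proof -
    have "c v = 0" if c: "(\<Sum>v\<in>?u ` {..<n}. coord_scale (c v) v) = 0" and v: "v \<in> ?u ` {..<n}"
      for c v
    proof -
      obtain i where i: "i < n" "v = ?u i" using v by auto
      have "(\<Sum>k<n. coord_scale (c (?u k)) (?u k)) = 0"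
        using c by (subst (asm) sum.reindex) (auto intro: inj_on_subset[OF inj])
      then show ?thesis using comb[of "\<lambda>k. c (?u k)" i] i by (simp add: zero_fun_def)
    qed
    then show ?thesis by (auto simp: dependent_finite)
  qed
  moreover have "span (?u ` {..<n}) = coord_space n"
  proof
    have "subspace (coord_space n :: (nat \<Rightarrow> 'r) set)"
      by (auto simp: subspace_def coord_space_def coord_scale_def)
    then show "span (?u ` {..<n}) \<subseteq> coord_space n"
      by (intro span_minimal) (auto simp: coord_space_def unit_vec_def)
    show "coord_space n \<subseteq> span (?u ` {..<n})"
    proof
      fix x :: "nat \<Rightarrow> 'r" assume "x \<in> coord_space n"
      then have "x = (\<Sum>k<n. coord_scale (x k) (?u k))"
        by (auto simp: fun_eq_iff comb coord_space_def)
      also have "\<dots> \<in> span (?u ` {..<n})"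
        by (intro span_sum span_scale span_base) auto
      finally show "x \<in> span (?u ` {..<n})" .
    qed
  qed
  ultimately show ?thesis unfolding fg_free_def using module_coord by blast
qed

lemma formed_space_coord_model:
  assumes M: "formed_space (M :: ('r::comm_ring_1, 'm::ab_group_add) fspace)"
  shows "\<exists>N :: ('r, nat \<Rightarrow> 'r) fspace. formed_space N \<and> M \<cong>\<^sub>F N"
proof -
  interpret module "smul M" using M by (simp add: formed_space_def fg_free_def)
  obtain B where B: "finite B" "independent B" "span B = car M"
    using M by (auto simp: formed_space_def fg_free_def)
  obtain n and b :: "nat \<Rightarrow> 'm" where b: "bij_betw b {..<n} B"
    using ex_bij_betw_nat_finite[OF B(1)] by (auto simp: atLeast0LessThan)
  have bB: "b i \<in> B" if "i < n" for i using b that by (auto simp: bij_betw_def)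
  define f where "f x = (\<lambda>i. if i < n then representation B x (b i) else 0)" for x
  define g where "g x = (\<Sum>i<n. smul M (x i) (b i))" for x :: "nat \<Rightarrow> 'r"
  let ?C = "coord_space n :: (nat \<Rightarrow> 'r) set"
  define N where "N = \<lparr>car = ?C, smul = coord_scale,
    form = (\<lambda>x y. form M (g x) (g y)), bd = (\<lambda>x. bd M (g x))\<rparr>"
  have gcar: "g x \<in> car M" for x
    unfolding g_def B(3)[symmetric] by (intro span_sum span_scale span_base bB) auto
  have gadd: "g (x + y) = g x + g y" for x y
    by (simp add: g_def scale_left_distrib sum.distrib)
  have gscale: "g (coord_scale r x) = smul M r (g x)" for r x
    by (simp add: g_def coord_scale_def scale_sum_right)
  have gf: "g (f x) = x" if "x \<in> car M" for x
  proof -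
    have "g (f x) = (\<Sum>i<n. smul M (representation B x (b i)) (b i))"
      by (simp add: g_def f_def)
    also have "\<dots> = (\<Sum>v\<in>B. smul M (representation B x v) v)"
      by (rule sum.reindex_bij_betw[OF b])
    also have "\<dots> = x" using that B by (intro sum_representation_eq) auto
    finally show ?thesis .
  qed
  have fg: "f (g x) = x" if x: "x \<in> ?C" for x
  proof -
    have "representation B (g x) (b i) = x i" if i: "i < n" for i
    proof -
      have "representation B (g x) (b i) = (\<Sum>k<n. representation B (smul M (x k) (b k)) (b i))"
        unfolding g_def using B bB
        by (subst representation_sum) (auto intro: span_scale span_base)
      also have "\<dots> = (\<Sum>k<n. if k = i then x k else 0)"
      proof (rule sum.cong)
        fix k assume k: "k \<in> {..<n}"
        have "b i = b k \<longleftrightarrow> k = i"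
          using b i k by (auto simp: bij_betw_def inj_on_def)
        then show "representation B (smul M (x k) (b k)) (b i) = (if k = i then x k else 0)"
          using k representation_scale[OF B(2) span_base[OF bB[of k]], of "x k"]
            representation_basis[OF B(2) bB[of k]] by simp
      qed simp
      also have "\<dots> = x i" using i by simp
      finally show ?thesis .
    qed
    then show ?thesis using x by (auto simp: f_def fun_eq_iff coord_space_def)
  qed
  have fadd: "f (x + y) = f x + f y" if "x \<in> car M" "y \<in> car M" for x y
    using that B by (auto simp: f_def fun_eq_iff representation_add)
  have fscale: "f (smul M r x) = coord_scale r (f x)" if "x \<in> car M" for r x
    using that B by (auto simp: f_def fun_eq_iff representation_scale coord_scale_def)
  have fcar: "f x \<in> ?C" for x by (auto simp: f_def coord_space_def)
  have lin: "linear_on ?C coord_scale (*) (\<lambda>x. h (g x))"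
    if "linear_on (car M) (smul M) (*) h" for h
    using that gcar by (auto simp: linear_on_def gadd gscale)
  have "formed_space N"
    using M gcar lin fg_free_coord[of n]
    by (auto simp: formed_space_def N_def)
  moreover have "M \<cong>\<^sub>F N"
    unfolding fs_iso_def
  proof (intro exI conjI)
    show "fs_morphism M N f"
      by (auto simp: fs_morphism_def N_def linear_on_def fadd fscale fcar gf)
    show "fs_morphism N M g"
      by (auto simp: fs_morphism_def N_def linear_on_def gadd gscale gcar)
    show "\<forall>x\<in>car M. g (f x) = x" using gf by blast
    show "\<forall>y\<in>car N. f (g y) = y" using fg by (simp add: N_def)
  qed
  ultimately show ?thesis by blast
qed

end

theory Submission
  imports Defs "Jordan_Normal_Form.Determinant"
begin

text \<open>
  Write \<open>\<partial>\<close> for \<open>bd M\<close> and \<open>\<lambda>\<close> for \<open>form M\<close>, and for \<open>k\<close> in \<open>M\<close> let \<open>twist M k\<close> be \<open>M\<close> with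
  the boundary \<open>\<partial>\<^sub>k = \<partial> + \<lambda>(-, k)\<close>. The idea is that stabilising by \<open>X\<close> loses nothing but a twist.
  The kernel of the boundary of \<open>M \<sharp> X\<close> is a copy of \<open>(M, \<lambda>)\<close>, and \<open>\<partial>\<close> is recovered on it
  by pairing with the generator \<open>(0, 1)\<close> of \<open>X\<close>. An isomorphism \<open>M1 \<sharp> X \<cong> M2 \<sharp> X\<close> identifies the
  two kernels. The preimage of the generator on the right differs from the generator on the left
  by an element of the kernel, because both have boundary \<open>1\<close>. Hence \<open>M2\<close> is
  isomorphic to a twist of \<open>M1\<close>, the lemma \<open>stably_iso_imp_twist_iso\<close>, and it remains to remove the twist when \<open>\<partial>\<close> and \<open>\<partial>\<^sub>k\<close> are both surjective.

  The tool is the Eichler transformation \<open>x \<mapsto> x + \<lambda>(x, a) e + \<lambda>(x, e) a\<close> for orthogonal \<open>e\<close> and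
  \<open>a\<close>. It preserves \<open>\<lambda>\<close> and replaces the twist \<open>k\<close> by \<open>k + \<partial>\<^sub>k(e) a + \<partial>\<^sub>k(a) e\<close>. An arc genus of
  at least \<open>2n + 1\<close> provides \<open>n\<close> hyperbolic pairs in the kernel of \<open>\<partial>\<close>: an isometric
  copy \<open>H\<close> of \<open>R\<^sup>2\<^sup>n\<close>, which splits off orthogonally. If \<open>R\<close> satisfies \<open>(S\<^sub>n)\<close>, three Eichler
  transformations suffice.
  \<^item> The values of \<open>\<partial>\<^sub>k\<close> on the hyperbolic basis together with one value \<open>\<partial>\<^sub>k(a)\<close>, where \<open>a\<close> is
    orthogonal to \<open>H\<close>, form a unimodular vector. By \<open>(S\<^sub>n)\<close> suitable multiples of \<open>\<partial>\<^sub>k(a)\<close> can be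
    added to the values at the \<open>f\<^sub>i\<close> so that the boundary maps \<open>H\<close> onto \<open>R\<close>, and a transformation
    given by \<open>a\<close> and a combination of the \<open>e\<^sub>i\<close> adds them (\<open>twist_onto_hyperbolic_part\<close>).
  \<^item> If \<open>x\<close> in \<open>H\<close> has \<open>\<partial>\<^sub>k(x) = 1\<close>, the transformation given by \<open>x\<close> and \<open>-p\<close>, with \<open>p\<close> the component
    of \<open>k\<close> orthogonal to \<open>H\<close>, moves the twist into \<open>H\<close> (\<open>twist_into_hyperbolic_part\<close>).
  \<^item> If \<open>k\<close> lies in \<open>H\<close>, then \<open>\<partial>\<^sub>k(k) = 0\<close>. There is a \<open>p\<close> orthogonal to \<open>H\<close> with \<open>\<partial>(p) = 1\<close>, and
    the transformation given by \<open>k\<close> and \<open>-p\<close> changes the twist to \<open>0\<close> (\<open>twist_hyperbolic_iso\<close>).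

  Since \<open>sr(R) \<le> usr(R)\<close>, the bound on the arc genus provides such an \<open>n\<close> if the stable rank is
  finite. If it is infinite, the arc genus would be infinite too, whereas a space generated by
  \<open>c\<close> elements contains at most \<open>c\<close> hyperbolic pairs (\<open>hyperbolic_pairs_le_generators\<close>).
\<close>


section \<open>Stable range in terms of coordinates\<close>

lemma unimodular_iff:
  "unimodular n (v :: nat \<Rightarrow> 'r::comm_ring_1) \<longleftrightarrow>
     v \<in> coord_space n \<and> (\<exists>c. (\<Sum>i<n. c i * v i) = 1)"
proof (intro iffI conjI)
  assume uni: "unimodular n v"
  then show v: "v \<in> coord_space n" by (simp add: unimodular_def)
  obtain \<phi> where lin: "linear_on (coord_space n) coord_scale (*) \<phi>"
    and \<phi>: "\<And>r. \<phi> (coord_scale r v) = r"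
    using uni by (auto simp: unimodular_def)
  have cs: "coord_scale r x \<in> coord_space n" if "x \<in> coord_space n" for r :: 'r and x
    using that by (auto simp: coord_space_def coord_scale_def)
  have unit: "Defs.unit_vec i \<in> (coord_space n :: (nat \<Rightarrow> 'r) set)" if "i < n" for i
    using that by (auto simp: coord_space_def Defs.unit_vec_def)
  define trunc where "trunc m = (\<lambda>i. if i < m then v i else 0)" for m
  have trunc: "trunc m \<in> coord_space n" for m
    using v by (auto simp: trunc_def coord_space_def)
  have partial: "\<phi> (trunc m) = (\<Sum>i<m. v i * \<phi> (Defs.unit_vec i))" if "m \<le> n" for m
    using that
  proof (induction m)
    case 0
    have "trunc 0 = trunc 0 + trunc 0" by (simp add: trunc_def fun_eq_iff)
    then have "\<phi> (trunc 0) = \<phi> (trunc 0) + \<phi> (trunc 0)"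
      using linear_onD(1)[OF lin trunc trunc] by metis
    then show ?case by simp
  next
    case (Suc m)
    have "trunc (Suc m) = trunc m + coord_scale (v m) (Defs.unit_vec m)"
      by (auto simp: trunc_def fun_eq_iff coord_scale_def Defs.unit_vec_def less_Suc_eq)
    then have "\<phi> (trunc (Suc m)) = \<phi> (trunc m) + \<phi> (coord_scale (v m) (Defs.unit_vec m))"
      using linear_onD(1)[OF lin trunc cs[OF unit]] Suc.prems by simp
    then show ?case
      using Suc linear_onD(2)[OF lin unit[of m]] by simp
  qed
  have "v = trunc n"
    using v by (auto simp: trunc_def coord_space_def fun_eq_iff)
  moreover have "\<phi> v = 1"
    using \<phi>[of 1] by (simp add: coord_scale_def)
  ultimately have "(\<Sum>i<n. \<phi> (Defs.unit_vec i) * v i) = 1"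
    using partial[of n] by (simp add: mult.commute)
  then show "\<exists>c. (\<Sum>i<n. c i * v i) = 1"
    by (rule exI[of _ "\<lambda>i. \<phi> (Defs.unit_vec i)"])
next
  assume *: "v \<in> coord_space n \<and> (\<exists>c. (\<Sum>i<n. c i * v i) = 1)"
  then obtain c where c: "(\<Sum>i<n. c i * v i) = 1" by blast
  have "linear_on (coord_space n) coord_scale (*) (\<lambda>x. \<Sum>i<n. c i * x i)"
    by (simp add: linear_on_def coord_scale_def algebra_simps sum.distrib sum_distrib_left)
  moreover have "(\<Sum>i<n. c i * coord_scale r v i) = r" for r
  proof -
    have "(\<Sum>i<n. c i * coord_scale r v i) = r * (\<Sum>i<n. c i * v i)"
      by (simp add: coord_scale_def sum_distrib_left algebra_simps)
    then show ?thesis using c by simp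
  qed
  ultimately show "unimodular n v"
    using * unfolding unimodular_def by blast
qed

lemma stable_rangeD:
  fixes b :: "nat \<Rightarrow> 'r::comm_ring_1"
  assumes "stable_range TYPE('r) n" and "(\<Sum>i<n. c i * b i) + s = 1"
  obtains t d where "(\<Sum>i<n. d i * (b i + t i * s)) = 1"
proof -
  let ?r = "\<lambda>i. if i < n then b i else if i = n then s else 0"
  have "(\<Sum>i<Suc n. (if i < n then c i else 1) * ?r i) = 1"
    using assms(2) by simp
  then have "\<exists>c. (\<Sum>i<Suc n. c i * ?r i) = 1"
    by (intro exI[of _ "\<lambda>i. if i < n then c i else 1"])
  then have "unimodular (Suc n) ?r"
    by (simp add: unimodular_iff coord_space_def del: sum.lessThan_Suc)
  then obtain t where "unimodular n (\<lambda>i. if i < n then ?r i + t i * ?r n else 0)"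
    using assms(1) unfolding stable_range_def by blast
  then obtain d where "(\<Sum>i<n. d i * (if i < n then ?r i + t i * ?r n else 0)) = 1"
    by (auto simp: unimodular_iff)
  then have "(\<Sum>i<n. d i * (b i + t i * s)) = 1" by simp
  then show thesis by (rule that)
qed


section \<open>The identity matrix does not factor through smaller rank\<close>

text \<open>Padding the factors with zeros to square matrices would give two matrices whose product has
  determinant \<open>1\<close> although one of them has a zero row.\<close>

lemma identity_factorization_rank:
  fixes A B :: "nat \<Rightarrow> nat \<Rightarrow> 'r::comm_ring_1"
  assumes AB: "\<And>i j. i < n \<Longrightarrow> j < n \<Longrightarrow> (\<Sum>a<c. A i a * B a j) = (if i = j then 1 else 0)"
  shows "n \<le> c"
proof (rule ccontr)
  assume "\<not> n \<le> c"
  then have c: "c < n" by simp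
  let ?A = "mat n n (\<lambda>(i, a). if a < c then A i a else 0)"
  let ?B = "mat n n (\<lambda>(a, j). if a < c then B a j else 0)"
  have prod: "?A * ?B = 1\<^sub>m n"
  proof (rule eq_matI)
    fix i j assume "i < dim_row (1\<^sub>m n :: 'r mat)" "j < dim_col (1\<^sub>m n :: 'r mat)"
    then have ij: "i < n" "j < n" by auto
    then have "(?A * ?B) $$ (i, j) =
        (\<Sum>a = 0..<n. (if a < c then A i a else 0) * (if a < c then B a j else 0))"
      by (simp add: scalar_prod_def)
    also have "\<dots> = (\<Sum>a<c. A i a * B a j)"
      using c by (intro sum.mono_neutral_cong_right) auto
    finally show "(?A * ?B) $$ (i, j) = 1\<^sub>m n $$ (i, j)" using AB ij by simp
  qed auto
  have zero: "det ?B = 0"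
  proof -
    have "(\<Prod>i = 0..<n. ?B $$ (i, p i)) = 0" if p: "p permutes {0..<n}" for p
    proof (rule prod_zero)
      have "p c < n" using permutes_in_image[OF p, of c] c by simp
      then show "\<exists>i\<in>{0..<n}. ?B $$ (i, p i) = 0" using c by (intro bexI[of _ c]) auto
    qed simp
    then show ?thesis by (simp add: det_def'[of ?B n])
  qed
  have "det (?A * ?B) = det ?A * det ?B" by (rule det_mult) auto
  then show False using prod zero by simp
qed


section \<open>Formed spaces and their isomorphisms\<close>

locale boundary_space =
  fixes M :: "('r::comm_ring_1, 'm::ab_group_add) fspace"
  assumes formed: "formed_space M"
begin

sublocale Modules.module "smul M"
  using formed by (simp add: formed_space_def fg_free_def)

lemma subspace_car: "subspace (car M)"
proof -
  obtain B where "span B = car M"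
    using formed by (auto simp: formed_space_def fg_free_def)
  then show ?thesis using subspace_span[of B] by simp
qed

lemmas car_0 [simp] = subspace_0[OF subspace_car]
lemmas car_add [simp] = subspace_add[OF subspace_car]
lemmas car_diff [simp] = subspace_diff[OF subspace_car]
lemmas car_neg [simp] = subspace_neg[OF subspace_car]
lemmas car_scale [simp] = subspace_scale[OF subspace_car]
lemmas car_sum = subspace_sum[OF subspace_car]

lemma form_add [simp]:
  assumes "x \<in> car M" "y \<in> car M" "z \<in> car M"
  shows "form M (x + y) z = form M x z + form M y z" "form M z (x + y) = form M z x + form M z y"
  using formed assms by (auto simp: formed_space_def linear_on_def)

lemma form_scale [simp]:
  assumes "x \<in> car M" "z \<in> car M"
  shows "form M (smul M r x) z = r * form M x z" "form M z (smul M r x) = r * form M z x"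
  using formed assms by (auto simp: formed_space_def linear_on_def)

lemma bd_add [simp]: "x \<in> car M \<Longrightarrow> y \<in> car M \<Longrightarrow> bd M (x + y) = bd M x + bd M y"
  and bd_scale [simp]: "x \<in> car M \<Longrightarrow> bd M (smul M r x) = r * bd M x"
  using formed by (auto simp: formed_space_def linear_on_def)

lemma form_self [simp]: "x \<in> car M \<Longrightarrow> form M x x = 0"
  using formed by (auto simp: formed_space_def)

lemma form_swap: "x \<in> car M \<Longrightarrow> y \<in> car M \<Longrightarrow> form M y x = - form M x y"
  using form_self[of "x + y"] form_self[of x] form_self[of y]
  by (simp add: eq_neg_iff_add_eq_0 add.commute del: form_self)

lemma form_0 [simp]: "x \<in> car M \<Longrightarrow> form M 0 x = 0" "x \<in> car M \<Longrightarrow> form M x 0 = 0"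
  using form_scale[of x x 0] by simp_all

lemma bd_0 [simp]: "bd M 0 = 0"
  using bd_scale[of 0 0] by simp

lemma form_neg [simp]:
  assumes "x \<in> car M" "y \<in> car M"
  shows "form M (- x) y = - form M x y" "form M x (- y) = - form M x y"
  using form_add(1)[of x "- x" y] form_add(2)[of y "- y" x] assms
  by (simp_all add: eq_neg_iff_add_eq_0 add.commute del: form_add)

lemma form_diff [simp]:
  assumes "x \<in> car M" "y \<in> car M" "z \<in> car M"
  shows "form M (x - y) z = form M x z - form M y z" "form M z (x - y) = form M z x - form M z y"
  using form_add[of x "- y" z] assms
  by (simp_all del: form_add)

lemma bd_neg [simp]: "x \<in> car M \<Longrightarrow> bd M (- x) = - bd M x"
  using bd_add[of x "- x"] by (simp add: eq_neg_iff_add_eq_0 add.commute del: bd_add)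

lemma bd_diff [simp]: "x \<in> car M \<Longrightarrow> y \<in> car M \<Longrightarrow> bd M (x - y) = bd M x - bd M y"
  using bd_add[of x "- y"] by (simp del: bd_add)

lemma form_sum_left:
  assumes "\<And>i. i \<in> A \<Longrightarrow> v i \<in> car M" and "y \<in> car M"
  shows "form M (sum v A) y = (\<Sum>i\<in>A. form M (v i) y)"
  using assms by (induction A rule: infinite_finite_induct) (auto simp: car_sum)

lemma form_sum_right:
  assumes "\<And>i. i \<in> A \<Longrightarrow> v i \<in> car M" and "y \<in> car M"
  shows "form M y (sum v A) = (\<Sum>i\<in>A. form M y (v i))"
  using assms by (induction A rule: infinite_finite_induct) (auto simp: car_sum)

lemma bd_sum:
  assumes "\<And>i. i \<in> A \<Longrightarrow> v i \<in> car M"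
  shows "bd M (sum v A) = (\<Sum>i\<in>A. bd M (v i))"
  using assms by (induction A rule: infinite_finite_induct) (auto simp: car_sum)

end

lemma fs_iso_sym: "M \<cong>\<^sub>F N \<Longrightarrow> N \<cong>\<^sub>F M"
  unfolding fs_iso_def by blast

lemma fs_morphism_comp:
  assumes "fs_morphism L M f" "fs_morphism M N g"
  shows "fs_morphism L N (\<lambda>x. g (f x))"
  using assms by (auto simp: fs_morphism_def linear_on_def image_subset_iff)

lemma fs_iso_trans:
  assumes "L \<cong>\<^sub>F M" "M \<cong>\<^sub>F N"
  shows "L \<cong>\<^sub>F N"
proof -
  obtain f f' where f: "fs_morphism L M f" "fs_morphism M L f'"
      "\<forall>x\<in>car L. f' (f x) = x" "\<forall>y\<in>car M. f (f' y) = y"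
    using assms(1) unfolding fs_iso_def by blast
  obtain g g' where g: "fs_morphism M N g" "fs_morphism N M g'"
      "\<forall>x\<in>car M. g' (g x) = x" "\<forall>y\<in>car N. g (g' y) = y"
    using assms(2) unfolding fs_iso_def by blast
  have "f x \<in> car M" if "x \<in> car L" for x
    using f(1) that by (auto simp: fs_morphism_def)
  moreover have "g' y \<in> car M" if "y \<in> car N" for y
    using g(2) that by (auto simp: fs_morphism_def)
  ultimately have "\<forall>x\<in>car L. f' (g' (g (f x))) = x" "\<forall>y\<in>car N. g (f (f' (g' y))) = y"
    using f(3,4) g(3,4) by auto
  then show ?thesis
    using fs_morphism_comp[OF f(1) g(1)] fs_morphism_comp[OF g(2) f(2)]
    unfolding fs_iso_def by blast
qed


section \<open>Twists of the boundary\<close>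

definition twist :: "('r::comm_ring_1, 'm::ab_group_add) fspace \<Rightarrow> 'm \<Rightarrow> ('r, 'm) fspace" where
  "twist M k = M\<lparr>bd := \<lambda>x. bd M x + form M x k\<rparr>"

lemma twist_simps [simp]:
  "car (twist M k) = car M" "smul (twist M k) = smul M" "form (twist M k) = form M"
  "bd (twist M k) x = bd M x + form M x k"
  by (simp_all add: twist_def)

text \<open>A morphism of the stabilised spaces maps the kernel of one boundary into the other. Both
  kernels are graphs of the functionals \<open>- bd M\<close> and \<open>- bd N\<close>, on which the correction term of the
  stabilised form vanishes.\<close>

lemma boundary_kernel_map:
  fixes M :: "('r::comm_ring_1, 'm::ab_group_add) fspace"
    and N :: "('r, 'n::ab_group_add) fspace"
  assumes "formed_space M" and F: "fs_morphism (M \<sharp> arc_space) (N \<sharp> arc_space) F"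
  defines "\<phi> \<equiv> \<lambda>x. fst (F (x, - bd M x))"
  shows "x \<in> car M \<Longrightarrow> \<phi> x \<in> car N"
    and "x \<in> car M \<Longrightarrow> F (x, - bd M x) = (\<phi> x, - bd N (\<phi> x))"
    and "linear_on (car M) (smul M) (smul N) \<phi>"
    and "x \<in> car M \<Longrightarrow> y \<in> car M \<Longrightarrow> form N (\<phi> x) (\<phi> y) = form M x y"
proof -
  interpret M: boundary_space M using assms(1) by unfold_locales
  have img: "F (x, c) \<in> car N \<times> UNIV" if "x \<in> car M" for x c
    using F that by (fastforce simp: fs_morphism_def fs_sum_def arc_space_def)
  show car: "\<phi> x \<in> car N" if "x \<in> car M" for x
    using img[OF that, of "- bd M x"] by (auto simp: \<phi>_def)
  have "bd (N \<sharp> arc_space) (F (x, - bd M x)) = bd (M \<sharp> arc_space) (x, - bd M x)"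
    if "x \<in> car M" for x
    using F that by (auto simp: fs_morphism_def fs_sum_def arc_space_def)
  then have "snd (F (x, - bd M x)) = - bd N (\<phi> x)" if "x \<in> car M" for x
    using that by (force simp: fs_sum_def arc_space_def \<phi>_def split_beta eq_neg_iff_add_eq_0
        add.commute)
  then show graph: "F (x, - bd M x) = (\<phi> x, - bd N (\<phi> x))" if "x \<in> car M" for x
    using that by (simp add: \<phi>_def prod_eq_iff)
  have add: "F (p + q) = F p + F q"
    if "p \<in> car M \<times> UNIV" "q \<in> car M \<times> UNIV" for p q
    using F that by (auto simp: fs_morphism_def fs_sum_def arc_space_def linear_on_def)
  have scale: "fst (F (smul M r x, r * c)) = smul N r (fst (F (x, c)))"
    if "x \<in> car M" for r x c
    using F that
    by (auto simp: fs_morphism_def fs_sum_def arc_space_def linear_on_def split_beta)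
  have "\<phi> (x + y) = \<phi> x + \<phi> y" if "x \<in> car M" "y \<in> car M" for x y
    using add[of "(x, - bd M x)" "(y, - bd M y)"] that by (simp add: \<phi>_def)
  moreover have "\<phi> (smul M r x) = smul N r (\<phi> x)" if "x \<in> car M" for r x
    using scale[OF that, of r "- bd M x"] that by (simp add: \<phi>_def)
  ultimately show "linear_on (car M) (smul M) (smul N) \<phi>"
    by (simp add: linear_on_def)
  have form: "form (N \<sharp> arc_space) (F p) (F q) = form (M \<sharp> arc_space) p q"
    if "p \<in> car M \<times> UNIV" "q \<in> car M \<times> UNIV" for p q
    using F that by (auto simp: fs_morphism_def fs_sum_def arc_space_def)
  show "form N (\<phi> x) (\<phi> y) = form M x y" if "x \<in> car M" "y \<in> car M" for x y
    using form[of "(x, - bd M x)" "(y, - bd M y)"] that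
    by (simp add: graph fs_sum_def arc_space_def)
qed

text \<open>The element \<open>k\<close> is the \<open>M\<close>-component of the preimage of the generator of \<open>X\<close>: pairing an
  element of the kernel of the boundary with that generator returns the boundary of its
  component in the original space.\<close>

lemma stably_iso_imp_twist_iso:
  fixes M :: "('r::comm_ring_1, 'm::ab_group_add) fspace"
    and N :: "('r, 'n::ab_group_add) fspace"
  assumes M: "formed_space M" and N: "formed_space N"
    and iso: "M \<sharp> arc_space \<cong>\<^sub>F N \<sharp> arc_space"
  obtains k where "k \<in> car M" "twist M k \<cong>\<^sub>F N"
proof -
  interpret M: boundary_space M using M by unfold_locales
  interpret N: boundary_space N using N by unfold_locales
  obtain F G where F: "fs_morphism (M \<sharp> arc_space) (N \<sharp> arc_space) F"
    and G: "fs_morphism (N \<sharp> arc_space) (M \<sharp> arc_space) G"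
    and GF: "\<forall>p\<in>car (M \<sharp> arc_space). G (F p) = p"
    and FG: "\<forall>q\<in>car (N \<sharp> arc_space). F (G q) = q"
    using iso unfolding fs_iso_def by blast
  define \<phi> where "\<phi> x = fst (F (x, - bd M x))" for x
  define \<psi> where "\<psi> y = fst (G (y, - bd N y))" for y
  note \<phi> = boundary_kernel_map[OF M F, folded \<phi>_def]
  note \<psi> = boundary_kernel_map[OF N G, folded \<psi>_def]
  have \<psi>\<phi>: "\<psi> (\<phi> x) = x" if "x \<in> car M" for x
  proof -
    have "G (F (x, - bd M x)) = (x, - bd M x)"
      using GF that by (simp add: fs_sum_def arc_space_def)
    then show ?thesis using \<phi>(2)[OF that] by (simp add: \<psi>_def)
  qed
  have \<phi>\<psi>: "\<phi> (\<psi> y) = y" if "y \<in> car N" for y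
  proof -
    have "F (G (y, - bd N y)) = (y, - bd N y)"
      using FG that by (simp add: fs_sum_def arc_space_def)
    then show ?thesis using \<psi>(2)[OF that] by (simp add: \<phi>_def)
  qed
  obtain k c where kc: "G (0, 1) = (k, c)" by (cases "G (0, 1)")
  have generator: "(0, 1) \<in> car (N \<sharp> arc_space)" by (simp add: fs_sum_def arc_space_def)
  then have "G (0, 1) \<in> car (M \<sharp> arc_space)"
    using G unfolding fs_morphism_def by blast
  then have k: "k \<in> car M" by (simp add: kc fs_sum_def arc_space_def)
  have "bd (M \<sharp> arc_space) (G (0, 1)) = bd (N \<sharp> arc_space) (0, 1)"
    using G generator unfolding fs_morphism_def by blast
  then have c: "c = 1 - bd M k"
    by (simp add: kc fs_sum_def arc_space_def algebra_simps)
  have bd: "bd N (\<phi> x) = bd M x + form M x k" if x: "x \<in> car M" for x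
  proof -
    have "bd N (\<phi> x) = form (N \<sharp> arc_space) (F (x, - bd M x)) (0, 1)"
      using \<phi>(1,2)[OF x] by (simp add: fs_sum_def arc_space_def)
    also have "(0, 1) = F (k, c)"
      using FG generator kc by force
    also have "form (N \<sharp> arc_space) (F (x, - bd M x)) (F (k, c)) =
        form (M \<sharp> arc_space) (x, - bd M x) (k, c)"
      using F x k by (auto simp: fs_morphism_def fs_sum_def arc_space_def)
    also have "\<dots> = bd M x + form M x k"
      by (simp add: fs_sum_def arc_space_def c algebra_simps)
    finally show ?thesis .
  qed
  have "fs_morphism (twist M k) N \<phi>"
    using \<phi> bd by (auto simp: fs_morphism_def)
  moreover have "bd M (\<psi> y) + form M (\<psi> y) k = bd N y" if "y \<in> car N" for y
    using bd[of "\<psi> y"] \<psi>(1) \<phi>\<psi> that by simp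
  then have "fs_morphism N (twist M k) \<psi>"
    using \<psi> by (auto simp: fs_morphism_def)
  ultimately have "twist M k \<cong>\<^sub>F N"
    using \<psi>\<phi> \<phi>\<psi> unfolding fs_iso_def by (intro exI[of _ \<phi>] exI[of _ \<psi>]) auto
  with k show thesis by (rule that)
qed

context boundary_space
begin

lemma twist_0_iso: "twist M 0 \<cong>\<^sub>F M"
proof -
  have "fs_morphism (twist M 0) M (\<lambda>x. x)" "fs_morphism M (twist M 0) (\<lambda>x. x)"
    by (auto simp: fs_morphism_def linear_on_def)
  then show ?thesis unfolding fs_iso_def by (intro exI[of _ "\<lambda>x. x"]) auto
qed

definition eichler :: "'m \<Rightarrow> 'm \<Rightarrow> 'm \<Rightarrow> 'm" where
  "eichler e a x = x + smul M (form M x a) e + smul M (form M x e) a"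

lemma eichler_car: "e \<in> car M \<Longrightarrow> a \<in> car M \<Longrightarrow> x \<in> car M \<Longrightarrow> eichler e a x \<in> car M"
  by (simp add: eichler_def)

lemma eichler_linear:
  "e \<in> car M \<Longrightarrow> a \<in> car M \<Longrightarrow> linear_on (car M) (smul M) (smul M) (eichler e a)"
  by (simp add: linear_on_def eichler_def scale_left_distrib scale_right_distrib
      algebra_simps)

lemma eichler_form:
  assumes "e \<in> car M" "a \<in> car M" "form M e a = 0" "x \<in> car M" "y \<in> car M"
  shows "form M (eichler e a x) (eichler e a y) = form M x y"
  using assms form_swap[of e a] form_swap[of e y] form_swap[of a y]
  by (simp add: eichler_def algebra_simps)

lemma eichler_inverse:
  assumes "e \<in> car M" "a \<in> car M" "form M e a = 0" "x \<in> car M"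
  shows "eichler e (- a) (eichler e a x) = x"
  using assms form_swap[of e a]
  by (simp add: eichler_def)

text \<open>The transformation given by \<open>e\<close> and \<open>a\<close> pulls the functional \<open>\<partial>\<^sub>k\<close> back to
  \<open>\<partial>\<^sub>k + \<partial>\<^sub>k(e) \<lambda>(-, a) + \<partial>\<^sub>k(a) \<lambda>(-, e)\<close>, which is again a twist of the boundary.\<close>

lemma twist_eichler_iso:
  assumes e: "e \<in> car M" and a: "a \<in> car M" and k: "k \<in> car M" and ea: "form M e a = 0"
  shows "twist M k \<cong>\<^sub>F
    twist M (k + smul M (bd (twist M k) e) a + smul M (bd (twist M k) a) e)"
    (is "_ \<cong>\<^sub>F twist M ?l")
proof -
  let ?E = "eichler e a" and ?E' = "eichler e (- a)"
  have bd: "bd (twist M k) (?E x) = bd (twist M ?l) x" if "x \<in> car M" for x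
    using that assms by (simp add: eichler_def algebra_simps)
  have E'E: "?E' (?E x) = x" and EE': "?E (?E' x) = x" if "x \<in> car M" for x
    using eichler_inverse[of e a x] eichler_inverse[of e "- a" x] that e a ea by simp_all
  have bd': "bd (twist M ?l) (?E' x) = bd (twist M k) x" if "x \<in> car M" for x
    using bd[of "?E' x"] EE'[OF that] that e a by (simp add: eichler_car del: twist_simps(4))
  have "fs_morphism (twist M ?l) (twist M k) ?E"
    unfolding fs_morphism_def using bd e a ea
    by (auto simp: eichler_car eichler_linear eichler_form simp del: twist_simps(4))
  moreover have "fs_morphism (twist M k) (twist M ?l) ?E'"
    unfolding fs_morphism_def using bd' e a ea
    by (auto simp: eichler_car eichler_linear eichler_form simp del: twist_simps(4))
  ultimately show ?thesis
    unfolding fs_iso_def using EE' E'E by (intro exI[of _ ?E'] exI[of _ ?E]) auto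
qed

end


section \<open>Removing a twist in the presence of hyperbolic pairs\<close>

locale hyperbolic_pairs = boundary_space M
  for M :: "('r::comm_ring_1, 'm::ab_group_add) fspace" +
  fixes n :: nat and e f :: "nat \<Rightarrow> 'm"
  assumes e_car [simp]: "i < n \<Longrightarrow> e i \<in> car M" and f_car [simp]: "i < n \<Longrightarrow> f i \<in> car M"
    and bd_e [simp]: "i < n \<Longrightarrow> bd M (e i) = 0" and bd_f [simp]: "i < n \<Longrightarrow> bd M (f i) = 0"
    and form_ee [simp]: "i < n \<Longrightarrow> j < n \<Longrightarrow> form M (e i) (e j) = 0"
    and form_ff [simp]: "i < n \<Longrightarrow> j < n \<Longrightarrow> form M (f i) (f j) = 0"
    and form_ef [simp]: "i < n \<Longrightarrow> j < n \<Longrightarrow> form M (e i) (f j) = (if i = j then 1 else 0)"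
begin

lemma form_fe [simp]: "i < n \<Longrightarrow> j < n \<Longrightarrow> form M (f i) (e j) = (if i = j then - 1 else 0)"
  using form_swap[of "e j" "f i"] by auto

definition hyp_span :: "'m set" where
  "hyp_span = span (e ` {..<n} \<union> f ` {..<n})"

lemma hyp_span_e: "i < n \<Longrightarrow> e i \<in> hyp_span" and hyp_span_f: "i < n \<Longrightarrow> f i \<in> hyp_span"
  by (auto simp: hyp_span_def intro: span_base)

lemma hyp_span_closed:
  "x \<in> hyp_span \<Longrightarrow> y \<in> hyp_span \<Longrightarrow> x + y \<in> hyp_span"
  "x \<in> hyp_span \<Longrightarrow> y \<in> hyp_span \<Longrightarrow> x - y \<in> hyp_span"
  "x \<in> hyp_span \<Longrightarrow> smul M r x \<in> hyp_span"
  "(\<And>i. i \<in> A \<Longrightarrow> v i \<in> hyp_span) \<Longrightarrow> sum v A \<in> hyp_span"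
  unfolding hyp_span_def by (auto intro: span_add span_diff span_scale span_sum)

lemma hyp_span_car: "x \<in> hyp_span \<Longrightarrow> x \<in> car M"
proof -
  have "span (e ` {..<n} \<union> f ` {..<n}) \<subseteq> car M"
    by (rule span_minimal[OF _ subspace_car]) auto
  then show "x \<in> hyp_span \<Longrightarrow> x \<in> car M" by (auto simp: hyp_span_def)
qed

lemma bd_hyp_span: "x \<in> hyp_span \<Longrightarrow> bd M x = 0"
proof -
  have "span (e ` {..<n} \<union> f ` {..<n}) \<subseteq> {x \<in> car M. bd M x = 0}"
    by (rule span_minimal) (auto simp: subspace_def)
  then show "x \<in> hyp_span \<Longrightarrow> bd M x = 0" by (auto simp: hyp_span_def)
qed

text \<open>The orthogonal projection onto the span of the hyperbolic pairs.\<close>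

definition hyp_proj :: "'m \<Rightarrow> 'm" where
  "hyp_proj x = (\<Sum>i<n. smul M (form M x (f i)) (e i) - smul M (form M x (e i)) (f i))"

lemma hyp_proj_in_span: "hyp_proj x \<in> hyp_span"
  unfolding hyp_proj_def
  by (intro hyp_span_closed hyp_span_e hyp_span_f) auto

lemma hyp_proj_car [simp]: "hyp_proj x \<in> car M"
  using hyp_proj_in_span hyp_span_car by blast

lemma form_hyp_proj:
  assumes "i < n" "x \<in> car M"
  shows "form M (hyp_proj x) (e i) = form M x (e i)" "form M (hyp_proj x) (f i) = form M x (f i)"
  unfolding hyp_proj_def using assms
  by (subst form_sum_left; simp add: if_distrib if_distribR cong: if_cong)+

lemma hyp_span_orthogonal:
  assumes "h \<in> hyp_span" "x \<in> car M"
  shows "form M h (x - hyp_proj x) = 0"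
proof -
  let ?p = "x - hyp_proj x"
  have perp: "form M (e i) ?p = 0" "form M (f i) ?p = 0" if "i < n" for i
    using that assms(2) form_swap[of ?p "e i"] form_swap[of ?p "f i"]
    by (simp_all add: form_hyp_proj)
  have p: "?p \<in> car M" using assms(2) by simp
  have "span (e ` {..<n} \<union> f ` {..<n}) \<subseteq> {h \<in> car M. form M h ?p = 0}"
    using p perp by (intro span_minimal) (auto simp: subspace_def simp del: form_diff)
  then show ?thesis using assms(1) by (auto simp: hyp_span_def)
qed

text \<open>Expanding the \<open>e\<^sub>i\<close> in the generators factors the matrix of the pairings of the \<open>e\<^sub>i\<close> with the
  \<open>f\<^sub>j\<close>, which is the identity, through the free module on the generators.\<close>

lemma hyperbolic_pairs_le_generators:
  assumes "finite B" "span B = car M"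
  shows "n \<le> card B"
proof -
  obtain b where b: "bij_betw b {..<card B} B"
    using ex_bij_betw_nat_finite[OF assms(1)] by (auto simp: atLeast0LessThan)
  have "\<exists>u. \<forall>i<n. e i = (\<Sum>v\<in>B. smul M (u i v) v)"
  proof -
    have "\<forall>i\<in>{..<n}. \<exists>u. e i = (\<Sum>v\<in>B. smul M (u v) v)"
      using e_car assms(2) span_finite[OF assms(1)] by fastforce
    from bchoice[OF this] show ?thesis by auto
  qed
  then obtain u where u: "\<And>i. i < n \<Longrightarrow> e i = (\<Sum>v\<in>B. smul M (u i v) v)" by blast
  have B: "v \<in> car M" if "v \<in> B" for v
    using span_base[OF that] assms(2) by simp
  show ?thesis
  proof (rule identity_factorization_rank)
    fix i j assume ij: "i < n" "j < n"
    have "(\<Sum>a<card B. u i (b a) * form M (b a) (f j)) = (\<Sum>v\<in>B. u i v * form M v (f j))"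
      by (rule sum.reindex_bij_betw[OF b])
    also have "\<dots> = form M (\<Sum>v\<in>B. smul M (u i v) v) (f j)"
      using B ij by (simp add: form_sum_left)
    also have "\<dots> = form M (e i) (f j)" using u ij by simp
    finally show "(\<Sum>a<card B. u i (b a) * form M (b a) (f j)) = (if i = j then 1 else 0)"
      using ij by simp
  qed
qed

text \<open>Write a vector with twisted boundary \<open>1\<close> as \<open>w - v + a\<close> with \<open>w\<close> in the span of the \<open>e\<^sub>i\<close>, \<open>v\<close> in
  the span of the \<open>f\<^sub>i\<close> and \<open>a\<close> orthogonal to both. The values of \<open>\<partial>\<^sub>k\<close> at the \<open>f\<^sub>i\<close> together with
  \<open>\<partial>\<^sub>k(w) + \<partial>\<^sub>k(a)\<close> form a unimodular vector of length \<open>n + 1\<close>, so the stable range condition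
  gives multiples of the last entry that make the other entries unimodular. An Eichler
  transformation given by \<open>a\<close> and a combination of the \<open>e\<^sub>i\<close> adds the multiples of \<open>\<partial>\<^sub>k(a)\<close>. It leaves
  the value at \<open>w\<close> unchanged since the \<open>e\<^sub>i\<close> are orthogonal to each other, so the multiples of \<open>\<partial>\<^sub>k(w)\<close>
  are available within the hyperbolic part.\<close>

lemma twist_onto_hyperbolic_part:
  assumes k: "k \<in> car M" and sr: "stable_range TYPE('r) n"
    and surj: "bd (twist M k) ` car M = UNIV"
  obtains l x where "l \<in> car M" "twist M k \<cong>\<^sub>F twist M l" "x \<in> hyp_span" "bd (twist M l) x = 1"
proof -
  let ?bd = "bd (twist M k)"
  obtain m where m: "m \<in> car M" "?bd m = 1"
    using surj by (metis UNIV_I imageE)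
  define a where "a = m - hyp_proj m"
  have a: "a \<in> car M" using m by (simp add: a_def)
  have perp: "form M h a = 0" if "h \<in> hyp_span" for h
    using hyp_span_orthogonal[OF that m(1)] by (simp add: a_def)
  define w where "w = (\<Sum>i<n. smul M (form M m (f i)) (e i))"
  have w_span: "w \<in> hyp_span"
    unfolding w_def by (intro hyp_span_closed hyp_span_e) auto
  then have w: "w \<in> car M" by (rule hyp_span_car)
  have proj: "hyp_proj m = w - (\<Sum>i<n. smul M (form M m (e i)) (f i))"
    by (simp add: hyp_proj_def w_def sum_subtractf)
  let ?v = "\<Sum>i<n. smul M (form M m (e i)) (f i)"
  have v: "?v \<in> car M" by (intro car_sum) auto
  have bd_sum_f: "bd (twist M z) (\<Sum>i<n. smul M (r i) (f i)) = (\<Sum>i<n. r i * bd (twist M z) (f i))"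
    if "z \<in> car M" for z r
    unfolding twist_simps using that
    by (subst bd_sum, simp, subst form_sum_left) (simp_all add: distrib_left sum.distrib)
  have "?bd ?v = (\<Sum>i<n. form M m (e i) * ?bd (f i))"
    using k by (rule bd_sum_f)
  moreover have "?bd (w - ?v + a) = ?bd w - ?bd ?v + ?bd a"
    using w v a k by simp
  moreover have "w - ?v + a = m" by (simp add: a_def proj)
  ultimately have "(\<Sum>i<n. - form M m (e i) * ?bd (f i)) + (?bd w + ?bd a) = 1"
    using m(2) by (simp add: sum_negf algebra_simps del: twist_simps(4))
  then obtain t d where td: "(\<Sum>i<n. d i * (?bd (f i) + t i * (?bd w + ?bd a))) = 1"
    by (rule stable_rangeD[OF sr])
  \<comment> \<open>The sign accounts for \<open>\<lambda>(f\<^sub>i, e\<^sub>i) = -1\<close>.\<close>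
  define u where "u = - (\<Sum>i<n. smul M (t i) (e i))"
  have u_span: "u \<in> hyp_span"
    unfolding u_def hyp_span_def
    by (intro span_neg span_sum span_scale span_base) auto
  then have u: "u \<in> car M" by (rule hyp_span_car)
  have sum_e: "(\<Sum>i<n. smul M (r i) (e i)) \<in> car M" for r
    by (intro car_sum) auto
  have form_sum_e: "form M x (\<Sum>i<n. smul M (r i) (e i)) = (\<Sum>i<n. r i * form M x (e i))"
    if "x \<in> car M" for x r
    using that by (subst form_sum_right) auto
  have f_u: "form M (f i) u = t i" if "i < n" for i
    using that sum_e by (simp add: u_def form_sum_e if_distrib if_distribR cong: if_cong)
  have "form M (e i) u = 0" if "i < n" for i
    using that sum_e by (simp add: u_def form_sum_e)
  then have w_u: "form M w u = 0"
    unfolding w_def using u by (subst form_sum_left) auto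
  define l where "l = k + smul M (?bd u) a + smul M (?bd a) u"
  have l: "l \<in> car M" using k a u by (simp add: l_def)
  have bd_l: "bd (twist M l) x = ?bd x + ?bd a * form M x u" if "x \<in> hyp_span" for x
    using hyp_span_car[OF that] perp[OF that] k a u by (simp add: l_def)
  \<comment> \<open>The multiple of \<open>w\<close> supplies the part of the correction that the transformation
    does not add to the values at the \<open>f\<^sub>i\<close>.\<close>
  define x where "x = (\<Sum>i<n. smul M (d i) (f i)) + smul M (\<Sum>i<n. d i * t i) w"
  have x_span: "x \<in> hyp_span"
    unfolding x_def by (intro hyp_span_closed hyp_span_f w_span) auto
  have sum_f: "(\<Sum>i<n. smul M (d i) (f i)) \<in> car M"
    by (intro car_sum) auto
  have "bd (twist M l) x =
      (\<Sum>i<n. d i * bd (twist M l) (f i)) + (\<Sum>i<n. d i * t i) * bd (twist M l) w"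
    unfolding bd_sum_f[OF l, symmetric] using w l sum_f
    by (simp add: x_def algebra_simps)
  also have "\<dots> = (\<Sum>i<n. d i * (?bd (f i) + ?bd a * t i)) + (\<Sum>i<n. d i * t i) * ?bd w"
    using bd_l[OF hyp_span_f] bd_l[OF w_span] f_u w_u by (simp del: twist_simps(4))
  also have "\<dots> = (\<Sum>i<n. d i * (?bd (f i) + t i * (?bd w + ?bd a)))"
    by (simp add: sum_distrib_left sum_distrib_right sum.distrib algebra_simps
        del: twist_simps(4))
  finally have "bd (twist M l) x = 1" using td by simp
  moreover have "twist M k \<cong>\<^sub>F twist M l"
    unfolding l_def by (rule twist_eichler_iso[OF u a k perp[OF u_span]])
  ultimately show thesis using l x_span that by blast
qed

text \<open>Since \<open>\<partial>\<^sub>k(x) = 1\<close>, the Eichler transformation given by \<open>x\<close> and \<open>- p\<close> subtracts exactly \<open>p\<close>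
  from the twist, at the cost of adding a multiple of \<open>x\<close>. With \<open>p\<close> the component of \<open>k\<close> orthogonal
  to the hyperbolic part, the result lies in that part.\<close>

lemma twist_into_hyperbolic_part:
  assumes k: "k \<in> car M" and x: "x \<in> hyp_span" "bd (twist M k) x = 1"
  obtains l where "l \<in> hyp_span" "twist M k \<cong>\<^sub>F twist M l"
proof -
  define p where "p = k - hyp_proj k"
  have p: "p \<in> car M" using k by (simp add: p_def)
  have "form M x p = 0" using hyp_span_orthogonal[OF x(1) k] by (simp add: p_def)
  then have "twist M k \<cong>\<^sub>F
      twist M (k + smul M (bd (twist M k) x) (- p) + smul M (bd (twist M k) (- p)) x)"
    using p k hyp_span_car[OF x(1)] by (intro twist_eichler_iso) auto
  also have "k + smul M (bd (twist M k) x) (- p) = hyp_proj k"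
    by (simp only: x(2) scale_one) (simp add: p_def)
  finally have "twist M k \<cong>\<^sub>F twist M (hyp_proj k + smul M (bd (twist M k) (- p)) x)" .
  moreover have "hyp_proj k + smul M (bd (twist M k) (- p)) x \<in> hyp_span"
    using x(1) hyp_proj_in_span by (intro hyp_span_closed)
  ultimately show thesis using that by blast
qed

text \<open>A twist \<open>k\<close> in the hyperbolic part satisfies \<open>\<partial>\<^sub>k(k) = 0\<close>, so an Eichler transformation given by
  \<open>k\<close> and an orthogonal vector only rescales the twist. If that vector has boundary \<open>- 1\<close>, the
  twist disappears. Such a vector exists because \<open>\<partial>\<close> vanishes on the hyperbolic part: projecting
  orthogonally away from that part does not change the boundary.\<close>

lemma twist_hyperbolic_iso:
  assumes k: "k \<in> hyp_span" and surj: "bd M ` car M = UNIV"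
  shows "twist M k \<cong>\<^sub>F M"
proof -
  obtain m where m: "m \<in> car M" "bd M m = 1"
    using surj by (metis UNIV_I imageE)
  define p where "p = m - hyp_proj m"
  have p: "p \<in> car M" "bd M p = 1"
    using m bd_hyp_span[OF hyp_proj_in_span] by (simp_all add: p_def)
  have kp: "form M k p = 0" using hyp_span_orthogonal[OF k m(1)] by (simp add: p_def)
  note k_car = hyp_span_car[OF k]
  have pk: "form M p k = 0" using form_swap[of k p] k_car p kp by simp
  have "twist M k \<cong>\<^sub>F
      twist M (k + smul M (bd (twist M k) k) (- p) + smul M (bd (twist M k) (- p)) k)"
    using k_car p kp by (intro twist_eichler_iso) auto
  also have "k + smul M (bd (twist M k) k) (- p) + smul M (bd (twist M k) (- p)) k = 0"
    using k_car p pk bd_hyp_span[OF k] by simp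
  finally show ?thesis using twist_0_iso fs_iso_trans by blast
qed

lemma twist_iso:
  assumes "k \<in> car M" "stable_range TYPE('r) n"
    and "bd M ` car M = UNIV" "bd (twist M k) ` car M = UNIV"
  shows "twist M k \<cong>\<^sub>F M"
proof -
  obtain l x where l: "l \<in> car M" "twist M k \<cong>\<^sub>F twist M l"
    and x: "x \<in> hyp_span" "bd (twist M l) x = 1"
    using twist_onto_hyperbolic_part[OF assms(1,2,4)] .
  obtain h where h: "h \<in> hyp_span" "twist M l \<cong>\<^sub>F twist M h"
    using twist_into_hyperbolic_part[OF l(1) x] .
  show ?thesis
    using fs_iso_trans[OF l(2) fs_iso_trans[OF h(2) twist_hyperbolic_iso[OF h(1) assms(3)]]] .
qed

end


section \<open>Hyperbolic pairs from arcs\<close>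

lemma unit_vec_apply: "Defs.unit_vec i j = (if j = i then 1 else 0)"
  by (simp add: Defs.unit_vec_def)

lemma arc_power_bd_unit_vec:
  "arc_power_bd g (Defs.unit_vec i :: nat \<Rightarrow> 'r::comm_ring_1) = (if i < g then 1 else 0)"
  by (induction g) (auto simp: unit_vec_apply)

lemma arc_power_form_unit_vec:
  "arc_power_form g (Defs.unit_vec i :: nat \<Rightarrow> 'r::comm_ring_1) (Defs.unit_vec j) =
     (if i < g \<and> j < g then if i < j then 1 else if j < i then - 1 else 0 else 0)"
proof (induction g)
  case (Suc g)
  then show ?case
    by (auto simp: arc_power_bd_unit_vec unit_vec_apply[of _ g])
qed simp

lemma arcs_of_iso_arc_power:
  fixes M :: "('r::comm_ring_1, 'm::ab_group_add) fspace"
    and M' :: "('r, 'n::ab_group_add) fspace"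
  assumes "formed_space M'" and "M \<cong>\<^sub>F M' \<sharp> arc_power g"
  obtains x where "\<forall>i<g. x i \<in> car M" "\<forall>i<g. bd M (x i) = 1"
    "\<forall>i<g. \<forall>j<g. form M (x i) (x j) = (if i < j then 1 else if j < i then - 1 else 0)"
proof -
  interpret M': boundary_space M' using assms(1) by unfold_locales
  let ?N = "M' \<sharp> arc_power g"
  obtain F where F: "fs_morphism ?N M F"
    using assms(2) unfolding fs_iso_def by blast
  let ?u = "\<lambda>i. (0 :: 'n, Defs.unit_vec i :: nat \<Rightarrow> 'r)"
  have u: "?u i \<in> car ?N" if "i < g" for i
    using that by (auto simp: fs_sum_def arc_power_def coord_space_def Defs.unit_vec_def)
  show thesis
  proof (rule that[of "\<lambda>i. F (?u i)"])
    show "\<forall>i<g. F (?u i) \<in> car M"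
      using F u unfolding fs_morphism_def by blast
    have "bd M (F (?u i)) = bd ?N (?u i)" if "i < g" for i
      using F u[OF that] unfolding fs_morphism_def by blast
    then show "\<forall>i<g. bd M (F (?u i)) = 1"
      by (simp add: fs_sum_def arc_power_def arc_power_bd_unit_vec)
    have "form M (F (?u i)) (F (?u j)) = form ?N (?u i) (?u j)" if "i < g" "j < g" for i j
      using F u[OF that(1)] u[OF that(2)] unfolding fs_morphism_def by blast
    then show "\<forall>i<g. \<forall>j<g. form M (F (?u i)) (F (?u j)) =
        (if i < j then 1 else if j < i then - 1 else 0)"
      by (simp add: fs_sum_def arc_power_def arc_power_form_unit_vec)
  qed
qed

text \<open>The \<open>2n\<close> differences of consecutive terms among \<open>2n + 1\<close> arcs lie in the kernel of the
  boundary, and the form on them is that of a chain: each difference pairs nontrivially with its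
  neighbours only. Hence the differences at even positions are orthogonal to each other, and so
  are those at odd positions. The latter are the \<open>f\<^sub>i\<close>, and the partial sums of the former are dual
  to them.\<close>

lemma hyperbolic_pairs_of_arcs:
  fixes M :: "('r::comm_ring_1, 'm::ab_group_add) fspace"
  assumes "formed_space M" and g: "2 * n + 1 \<le> g"
    and x_car: "\<And>i. i < g \<Longrightarrow> x i \<in> car M" and x_bd: "\<And>i. i < g \<Longrightarrow> bd M (x i) = 1"
    and x_form: "\<And>i j. i < g \<Longrightarrow> j < g \<Longrightarrow>
       form M (x i) (x j) = (if i < j then 1 else if j < i then - 1 else 0)"
  shows "hyperbolic_pairs M n (\<lambda>i. \<Sum>j\<le>i. x (2 * j + 1) - x (2 * j))
    (\<lambda>i. x (2 * i + 2) - x (2 * i + 1))"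
proof -
  interpret boundary_space M using assms(1) by unfold_locales
  define y where "y i = x (Suc i) - x i" for i
  have y_car [simp]: "y i \<in> car M" and y_bd [simp]: "bd M (y i) = 0" if "i < 2 * n" for i
    using that g by (simp_all add: y_def x_car x_bd)
  have y_form [simp]: "form M (y i) (y j) = (if j = Suc i then 1 else if i = Suc j then - 1 else 0)"
    if "i < 2 * n" "j < 2 * n" for i j
    using that g by (auto simp: y_def x_car x_form)
  have sum_car: "(\<Sum>j\<le>i. y (2 * j)) \<in> car M" if "i < n" for i
    using that by (intro car_sum) auto
  have "bd M (\<Sum>j\<le>i. y (2 * j)) = 0" if "i < n" for i
    using that by (subst bd_sum) auto
  moreover have "form M (\<Sum>a\<le>i. y (2 * a)) (\<Sum>b\<le>j. y (2 * b)) = 0" if "i < n" "j < n" for i j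
  proof -
    have "form M (y (2 * a)) (\<Sum>b\<le>j. y (2 * b)) = 0" if "a \<le> i" for a
    proof -
      have "2 * b \<noteq> Suc (2 * a)" "2 * a \<noteq> Suc (2 * b)" for a b :: nat by presburger+
      then show ?thesis using that \<open>i < n\<close> \<open>j < n\<close> by (subst form_sum_right) auto
    qed
    then show ?thesis using that sum_car by (subst form_sum_left) auto
  qed
  moreover have "form M (y (2 * i + 1)) (y (2 * j + 1)) = 0" if "i < n" "j < n" for i j
  proof -
    have "2 * j + 1 \<noteq> Suc (2 * i + 1)" "2 * i + 1 \<noteq> Suc (2 * j + 1)" by presburger+
    then show ?thesis using that by simp
  qed
  moreover have "form M (\<Sum>a\<le>i. y (2 * a)) (y (2 * j + 1)) = (if i = j then 1 else 0)"
    if "i < n" "j < n" for i j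
  proof -
    have "form M (\<Sum>a\<le>i. y (2 * a)) (y (2 * j + 1)) =
        (\<Sum>a\<le>i. (if a = j then 1 else 0) - (if a = Suc j then 1 else 0))"
      using that by (subst form_sum_left) (auto intro!: sum.cong)
    also have "\<dots> = (if i = j then 1 else 0)"
      by (auto simp: sum_subtractf)
    finally show ?thesis .
  qed
  ultimately have "hyperbolic_pairs M n (\<lambda>i. \<Sum>j\<le>i. y (2 * j)) (\<lambda>i. y (2 * i + 1))"
    using sum_car by unfold_locales simp_all
  then show ?thesis by (simp add: y_def)
qed

lemma hyperbolic_pairs_of_arc_genus:
  fixes M :: "('r::comm_ring_1, 'm::ab_group_add) fspace"
  assumes M: "formed_space M" and n: "enat (2 * n + 1) \<le> arc_genus M"
  obtains e f where "hyperbolic_pairs M n e f"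
proof -
  have "enat (2 * n) < arc_genus M" using n by (rule less_le_trans[rotated]) simp
  then obtain g and M' :: "('r, nat \<Rightarrow> 'r) fspace"
    where g: "2 * n < g" and M': "formed_space M'" "M \<cong>\<^sub>F M' \<sharp> arc_power g"
    unfolding arc_genus_def less_Sup_iff by auto
  have g': "2 * n + 1 \<le> g" using g by simp
  obtain x where "\<forall>i<g. x i \<in> car M" "\<forall>i<g. bd M (x i) = 1"
    "\<forall>i<g. \<forall>j<g. form M (x i) (x j) = (if i < j then 1 else if j < i then - 1 else 0)"
    by (rule arcs_of_iso_arc_power[OF M'])
  then show thesis
    by (intro that[OF hyperbolic_pairs_of_arcs[OF M g', of x]]) simp_all
qed

lemma arc_genus_finite:
  assumes "formed_space M"
  shows "arc_genus M \<noteq> \<infinity>"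
proof
  assume inf: "arc_genus M = \<infinity>"
  obtain B where B: "finite B" "Modules.module.span (smul M) B = car M"
    using assms by (auto simp: formed_space_def fg_free_def)
  obtain e f where "hyperbolic_pairs M (Suc (card B)) e f"
    using hyperbolic_pairs_of_arc_genus[OF assms, of "Suc (card B)"] inf by auto
  then have "Suc (card B) \<le> card B"
    by (rule hyperbolic_pairs.hyperbolic_pairs_le_generators[OF _ B])
  then show False by simp
qed


section \<open>Cancellation\<close>

lemma stable_range_attained:
  assumes "sr TYPE('r::comm_ring_1) \<noteq> \<infinity>"
  obtains n where "sr TYPE('r) = enat n" "stable_range TYPE('r) n"
proof -
  let ?S = "{enat n | n. stable_range TYPE('r) n}"
  have ex: "\<exists>n. stable_range TYPE('r) n"
  proof (rule ccontr)
    assume "\<nexists>n. stable_range TYPE('r) n"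
    then have "?S = {}" by blast
    then show False using assms by (simp add: sr_def top_enat_def)
  qed
  let ?n = "LEAST n. stable_range TYPE('r) n"
  have n: "stable_range TYPE('r) ?n" using ex by (rule LeastI_ex)
  have "Inf ?S = enat ?n"
  proof (rule antisym)
    show "Inf ?S \<le> enat ?n" by (rule Inf_lower) (use n in blast)
    show "enat ?n \<le> Inf ?S" by (rule Inf_greatest) (use Least_le in fastforce)
  qed
  then show thesis using n that by (simp add: sr_def)
qed

lemma sr_le_usr: "sr R \<le> usr R"
  unfolding usr_def by (rule Inf_greatest) auto

theorem theorem4p1:
  fixes M1 :: "('r::comm_ring_1, 'm::ab_group_add) fspace"
    and M2 :: "('r, 'n::ab_group_add) fspace"
  assumes "formed_space M1" and "formed_space M2"
    and "bd M1 ` car M1 = UNIV" and "bd M2 ` car M2 = UNIV"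
    and "M1 \<sharp> arc_space \<cong>\<^sub>F M2 \<sharp> arc_space"
    and "arc_genus M1 \<ge> 2 * usr TYPE('r) + 5"
  shows "M1 \<cong>\<^sub>F M2"
proof -
  have genus: "2 * sr TYPE('r) + 5 \<le> arc_genus M1"
    using add_right_mono[OF mult_left_mono[OF sr_le_usr[of "TYPE('r)"] zero_le]] assms(6)
    by (rule order_trans)
  have "sr TYPE('r) \<noteq> \<infinity>"
  proof
    assume "sr TYPE('r) = \<infinity>"
    then have "2 * sr TYPE('r) + 5 = \<infinity>" by (simp add: numeral_eq_enat)
    then show False using genus arc_genus_finite[OF assms(1)] by simp
  qed
  then obtain n where n: "sr TYPE('r) = enat n" "stable_range TYPE('r) n"
    by (rule stable_range_attained)
  have "enat (2 * n + 1) \<le> 2 * sr TYPE('r) + 5"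
    by (simp add: n numeral_eq_enat)
  then obtain e f where "hyperbolic_pairs M1 n e f"
    using hyperbolic_pairs_of_arc_genus[OF assms(1) order_trans[OF _ genus]] by blast
  then interpret hyperbolic_pairs M1 n e f .
  obtain k where k: "k \<in> car M1" and iso: "twist M1 k \<cong>\<^sub>F M2"
    using stably_iso_imp_twist_iso[OF assms(1,2,5)] .
  then obtain G where G: "fs_morphism M2 (twist M1 k) G"
    unfolding fs_iso_def by blast
  have "bd M2 ` car M2 \<subseteq> bd (twist M1 k) ` car M1"
  proof (rule image_subsetI)
    fix y assume "y \<in> car M2"
    then have "bd (twist M1 k) (G y) = bd M2 y" "G y \<in> car (twist M1 k)"
      using G unfolding fs_morphism_def by blast+
    then show "bd M2 y \<in> bd (twist M1 k) ` car M1"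
      using image_eqI[of "bd M2 y" "bd (twist M1 k)" "G y" "car M1"]
      by (simp del: twist_simps(4))
  qed
  then have "bd (twist M1 k) ` car M1 = UNIV"
    by (simp only: assms(4) top.extremum_unique)
  then have "twist M1 k \<cong>\<^sub>F M1"
    by (rule twist_iso[OF k n(2) assms(3)])
  then show ?thesis by (rule fs_iso_trans[OF fs_iso_sym iso])
qed

end
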